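(* A sequence $A\in2^\omega$ is $\mathrm{K}$-trivial (i.e. there is $c$ with $\mathrm{K}(A\upharpoonright n)\le \mathrm{K}(n)+c$ for all $n$) if and only if it is $g_{\mathrm S}$-trivial (i.e. there is $c$ with $\mathrm{K}(A\upharpoonright n)\le g_{\mathrm S}(n)+c$ for all $n$), where $g_{\mathrm S}$ is the function defined below.
   Context: $\mathrm{K}$ denotes prefix-free Kolmogorov complexity defined via a fixed universal prefix-free machine $\mathbb{U}$; natural numbers are identified with binary strings, and $\langle\cdot,\cdot,\cdot\rangle$ is the usual effective bijection from triples of strings to strings. The function $g_{\mathrm S}$ is defined by $g_{\mathrm S}(\langle x,p,t\rangle)=|p|$ if $\mathbb{U}$ on input $p$ outputs $x$ in exactly $t$ steps of computation, and $g_{\mathrm S}(\langle x,p,t\rangle)=2|\langle x,p,t\rangle|$ otherwise. *)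

theory Defs
  imports Main "HOL-Library.Sublist" "HOL-Library.Nat_Bijection" "HOL-Library.Extended_Nat"
begin

type_synonym str = "bool list"

(* Length-lexicographic identification of numbers with strings (False = 0, True = 1):
   0, 1, 2, 3, 4, ... correspond to the empty string, 0, 1, 00, 01, ... *)

definition num_of_str :: "str \<Rightarrow> nat" where
  "num_of_str = foldl (\<lambda>n b. 2 * n + (if b then 2 else 1)) 0"

fun str_of_num :: "nat \<Rightarrow> str" where
  "str_of_num 0 = []"
| "str_of_num (Suc n) = str_of_num (n div 2) @ [odd n]"

lemma num_of_str_of_num [simp]: "num_of_str (str_of_num n) = n"
proof (induction n rule: str_of_num.induct)
  case (2 n)
  then show ?case by (cases "odd n") (auto simp: num_of_str_def elim!: oddE evenE)
qed (simp add: num_of_str_def)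

lemma str_of_num_of_str [simp]: "str_of_num (num_of_str w) = w"
  by (induction w rule: rev_induct) (auto simp: num_of_str_def)

lemma bij_str_of_num: "bij str_of_num"
  by (rule o_bij[where g = num_of_str]) (auto simp: fun_eq_iff)

fun triple :: "str \<times> str \<times> str \<Rightarrow> str" where
  "triple (x, p, t) =
     str_of_num (prod_encode (num_of_str x, prod_encode (num_of_str p, num_of_str t)))"

lemma bij_triple: "bij triple"
proof (rule o_bij)
  let ?d = "\<lambda>w. case prod_decode (num_of_str w) of (a, m) \<Rightarrow>
    (case prod_decode m of (b, c) \<Rightarrow> (str_of_num a, str_of_num b, str_of_num c))"
  show "?d \<circ> triple = id"
    by (auto simp: fun_eq_iff)
  show "triple \<circ> ?d = id"
  proof (rule ext)
    fix w
    obtain a m where am: "prod_decode (num_of_str w) = (a, m)" by fastforce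
    obtain b c where bc: "prod_decode m = (b, c)" by fastforce
    have "prod_encode (b, c) = m" "prod_encode (a, m) = num_of_str w"
      by (metis am bc prod_decode_inverse)+
    then show "(triple \<circ> ?d) w = id w"
      by (simp add: am bc)
  qed
qed

(* Machines are finite programs acting on string-valued registers used as stacks, with the
   top of the stack at the head of the list.  Pop r k0 k1 ke jumps to ke if register r is
   empty; otherwise it removes the top bit and jumps to k0 or k1 according to its value.
   The input is placed in register 0, all other registers are initially empty, and the
   output is read off register 0 when control leaves the program. *)

datatype instr = Push nat bool | Pop nat nat nat nat

type_synonym machine = "instr list"
type_synonym config = "nat \<times> (nat \<Rightarrow> str)"

fun halted :: "machine \<Rightarrow> config \<Rightarrow> bool" where
  "halted M (pc, R) \<longleftrightarrow> length M \<le> pc"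

fun step :: "machine \<Rightarrow> config \<Rightarrow> config" where
  "step M (pc, R) =
     (if halted M (pc, R) then (pc, R)
      else case M ! pc of
        Push r b \<Rightarrow> (Suc pc, R(r := b # R r))
      | Pop r k0 k1 ke \<Rightarrow>
          (case R r of
             [] \<Rightarrow> (ke, R)
           | b # w \<Rightarrow> (if b then k1 else k0, R(r := w))))"

definition initial :: "str \<Rightarrow> config" where
  "initial p = (0, (\<lambda>_. [])(0 := p))"

definition outputs_in :: "machine \<Rightarrow> str \<Rightarrow> str \<Rightarrow> nat \<Rightarrow> bool" where
  "outputs_in M p x t \<longleftrightarrow>
     halted M ((step M ^^ t) (initial p)) \<and>
     (\<forall>s<t. \<not> halted M ((step M ^^ s) (initial p))) \<and>
     snd ((step M ^^ t) (initial p)) 0 = x"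

definition outputs :: "machine \<Rightarrow> str \<Rightarrow> str \<Rightarrow> bool" where
  "outputs M p x \<longleftrightarrow> (\<exists>t. outputs_in M p x t)"

definition prefix_free_machine :: "machine \<Rightarrow> bool" where
  "prefix_free_machine M \<longleftrightarrow>
     (\<forall>p q. (\<exists>x. outputs M p x) \<and> (\<exists>y. outputs M q y) \<and> prefix p q \<longrightarrow> p = q)"

(* Universality by adjunction; the equivalence says that U on (rho @ p) and M on p agree
   as partial computations, including divergence. *)

definition universal_prefix_free :: "machine \<Rightarrow> bool" where
  "universal_prefix_free U \<longleftrightarrow>
     prefix_free_machine U \<and>
     (\<forall>M. prefix_free_machine M \<longrightarrow>
        (\<exists>\<rho>. \<forall>p x. outputs U (\<rho> @ p) x \<longleftrightarrow> outputs M p x))"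

definition K :: "machine \<Rightarrow> str \<Rightarrow> enat" where
  "K U x = (INF p\<in>{p. outputs U p x}. enat (length p))"

definition restrict_seq :: "(nat \<Rightarrow> bool) \<Rightarrow> nat \<Rightarrow> str" where
  "restrict_seq A n = map A [0..<n]"

definition K_trivial :: "machine \<Rightarrow> (nat \<Rightarrow> bool) \<Rightarrow> bool" where
  "K_trivial U A \<longleftrightarrow>
     (\<exists>c::nat. \<forall>n. K U (restrict_seq A n) \<le> K U (str_of_num n) + enat c)"

definition g_trivial :: "machine \<Rightarrow> (nat \<Rightarrow> nat) \<Rightarrow> (nat \<Rightarrow> bool) \<Rightarrow> bool" where
  "g_trivial U g A \<longleftrightarrow>
     (\<exists>c::nat. \<forall>n. K U (restrict_seq A n) \<le> enat (g n + c))"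

definition g_S :: "machine \<Rightarrow> nat \<Rightarrow> nat" where
  "g_S U n =
     (case inv triple (str_of_num n) of (x, p, t) \<Rightarrow>
        if outputs_in U p x (num_of_str t) then length p
        else 2 * length (str_of_num n))"

lemma g_S_triple:
  "g_S U (num_of_str (triple (x, p, t))) =
     (if outputs_in U p x (num_of_str t) then length p else 2 * length (triple (x, p, t)))"
  unfolding g_S_def str_of_num_of_str inv_f_f[OF bij_is_inj[OF bij_triple]] by simp

end

(* Idea.  Running a program p of U while counting its steps t yields a prefix-free machine that
   maps p to <x,p,t>; together with the code of length 2|w| + 1 for an arbitrary string w this
   gives K(n) <= g_S(n) + O(1), hence one direction.  Conversely, let p be a shortest program of
   n and t its running time.  For m = <n,p,t> we have g_S(m) = |p| = K(n).  Since n <= m, and n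
   can be decoded from m, the length of A|m, the string A|n is computable from A|m.  So
   K(A|n) <= K(A|m) + O(1) <= g_S(m) + O(1) = K(n) + O(1). *)
theory Submission
  imports Defs
begin

text \<open>Universality is a statement about concrete register machines, so both computations of
  the overview and a decoder for the code of length 2|w| + 1 are written out as programs. The
  obstacle is prefix-freeness. \<open>run_logger\<close> and \<open>initial_segment\<close> inherit
  it from \<open>U\<close> because their domains lie inside that of \<open>U\<close>; so they have
  to diverge wherever \<open>U\<close> does, and divergence is tracked through the program
  constructs alongside terminating execution. The simulation has to report the exact step count,
  since \<open>g_S\<close> takes its default value for any other \<open>t\<close>. In the converse
  direction \<open>n\<close> is recovered from the mere length of the string A|m, so the program
  needs neither \<open>p\<close> nor \<open>t\<close> as extra input.\<close>

type_synonym regs = "nat \<Rightarrow> str"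

section \<open>Runs of a machine\<close>

definition reach :: "machine \<Rightarrow> config \<Rightarrow> config \<Rightarrow> bool" where
  "reach M c c' \<longleftrightarrow> (\<exists>k. (step M ^^ k) c = c')"

lemma reach_refl: "reach M c c"
  unfolding reach_def by (rule exI[of _ 0]) simp

lemma reach_trans: "reach M c d \<Longrightarrow> reach M d e \<Longrightarrow> reach M c e"
proof -
  assume "reach M c d" "reach M d e"
  then obtain k l where "(step M ^^ k) c = d" "(step M ^^ l) d = e"
    unfolding reach_def by blast
  then have "(step M ^^ (l + k)) c = e" by (simp add: funpow_add)
  then show ?thesis unfolding reach_def by blast
qed

lemma reach_step: "reach M (step M c) d \<Longrightarrow> reach M c d"
  by (rule reach_trans[of _ _ "step M c"]) (auto simp: reach_def intro: exI[of _ 1])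

lemma reach_Push:
  "reach M (Suc pc, R(r := b # R r)) d \<Longrightarrow> pc < length M \<Longrightarrow> M ! pc = Push r b
    \<Longrightarrow> reach M (pc, R) d"
  by (rule reach_step) simp

lemma reach_Pop_Nil:
  "reach M (ke, R) d \<Longrightarrow> pc < length M \<Longrightarrow> M ! pc = Pop r k0 k1 ke \<Longrightarrow> R r = []
    \<Longrightarrow> reach M (pc, R) d"
  by (rule reach_step) simp

lemma reach_Pop_Cons:
  "reach M (if b then k1 else k0, R(r := w)) d \<Longrightarrow> pc < length M
    \<Longrightarrow> M ! pc = Pop r k0 k1 ke \<Longrightarrow> R r = b # w \<Longrightarrow> reach M (pc, R) d"
  by (rule reach_step) simp

lemma reach_jump:
  "reach M (k, R) d \<Longrightarrow> Suc pc < length M \<Longrightarrow> M ! pc = Push r False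
    \<Longrightarrow> M ! Suc pc = Pop r k k k \<Longrightarrow> reach M (pc, R) d"
  by (rule reach_Push[of _ _ _ r False], rule reach_Pop_Cons[of _ False]) auto

lemma funpow_halted: "halted M c \<Longrightarrow> (step M ^^ k) c = c"
proof (induction k)
  case (Suc k)
  then show ?case by (cases c) simp
qed simp

lemma halted_mono:
  assumes "halted M ((step M ^^ k) c)" "k \<le> l"
  shows "(step M ^^ l) c = (step M ^^ k) c"
proof -
  have "(step M ^^ l) c = (step M ^^ (l - k)) ((step M ^^ k) c)"
    using assms(2) by (simp flip: funpow_add comp_apply[of "step M ^^ (l - k)"])
  then show ?thesis using funpow_halted[OF assms(1)] by simp
qed

lemma reach_halted_unique:
  assumes "reach M c d" "halted M d" "reach M c e" "halted M e"
  shows "d = e"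
proof -
  obtain k l where "(step M ^^ k) c = d" "(step M ^^ l) c = e"
    using assms unfolding reach_def by blast
  then show ?thesis using halted_mono assms by (metis nat_le_linear)
qed

text \<open>Halted configurations are fixed points of \<open>step\<close>, so the first halting
  configuration agrees with any later one. This frees the arguments about programs from exact
  running times.\<close>

lemma outputs_iff_reach:
  "outputs M p x \<longleftrightarrow> (\<exists>c. reach M (initial p) c \<and> halted M c \<and> snd c 0 = x)"
proof
  assume "outputs M p x"
  then show "\<exists>c. reach M (initial p) c \<and> halted M c \<and> snd c 0 = x"
    unfolding outputs_def outputs_in_def reach_def by blast
next
  assume "\<exists>c. reach M (initial p) c \<and> halted M c \<and> snd c 0 = x"
  then obtain k where k: "halted M ((step M ^^ k) (initial p))"
      "snd ((step M ^^ k) (initial p)) 0 = x"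
    unfolding reach_def by blast
  define t where "t = (LEAST k. halted M ((step M ^^ k) (initial p)))"
  have t: "halted M ((step M ^^ t) (initial p))"
    unfolding t_def by (rule LeastI[of _ k]) (rule k)
  have "t \<le> k" unfolding t_def by (rule Least_le) (rule k)
  then have "(step M ^^ k) (initial p) = (step M ^^ t) (initial p)"
    by (rule halted_mono[OF t])
  moreover have "\<not> halted M ((step M ^^ s) (initial p))" if "s < t" for s
    using not_less_Least that unfolding t_def by blast
  ultimately have "outputs_in M p x t" unfolding outputs_in_def using t k by auto
  then show "outputs M p x" unfolding outputs_def by blast
qed

lemma outputs_functional: "outputs M p x \<Longrightarrow> outputs M p y \<Longrightarrow> x = y"
  unfolding outputs_iff_reach using reach_halted_unique by metis

section \<open>Divergence of deterministic runs\<close>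

definition runs_forever :: "machine \<Rightarrow> config \<Rightarrow> bool" where
  "runs_forever M c \<longleftrightarrow> (\<forall>d. reach M c d \<longrightarrow> \<not> halted M d)"

lemma reach_linear: "reach M c d \<Longrightarrow> reach M c e \<Longrightarrow> reach M d e \<or> reach M e d"
proof -
  assume "reach M c d" "reach M c e"
  then obtain k l where "(step M ^^ k) c = d" "(step M ^^ l) c = e"
    unfolding reach_def by blast
  then have "(step M ^^ (l - k)) d = e \<or> (step M ^^ (k - l)) e = d"
    by (cases "k \<le> l") (auto simp flip: funpow_add comp_apply[of "step M ^^ _"])
  then show ?thesis unfolding reach_def by blast
qed

lemma reach_runs_forever:
  assumes "reach M c d" "runs_forever M d"
  shows "runs_forever M c"
  unfolding runs_forever_def
proof (intro allI impI notI)
  fix e assume e: "reach M c e" "halted M e"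
  from reach_linear[OF assms(1) e(1)] show False
  proof
    assume "reach M d e"
    then show False using assms(2) e(2) unfolding runs_forever_def by blast
  next
    assume "reach M e d"
    then have "d = e" using funpow_halted[OF e(2)] unfolding reach_def by auto
    then show False using assms(2) e(2) reach_refl unfolding runs_forever_def by blast
  qed
qed

section \<open>Relocatable program fragments\<close>

text \<open>A fragment maps the address at which it is placed to its code; it is entered at its
  first instruction and left at the address directly behind its last one.\<close>

type_synonym frag = "nat \<Rightarrow> instr list"

text \<open>Quantifying over all surrounding code \<open>P\<close> and \<open>S\<close> makes the
  relation independent of the context, so that facts about fragments compose although jump targets
  are absolute addresses.\<close>

definition exec :: "frag \<Rightarrow> regs \<Rightarrow> regs \<Rightarrow> bool" where
  "exec C R R' \<longleftrightarrow>
     (\<forall>P S. reach (P @ C (length P) @ S) (length P, R) (length P + length (C (length P)), R'))"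

definition diverges :: "frag \<Rightarrow> regs \<Rightarrow> bool" where
  "diverges C R \<longleftrightarrow> (\<forall>P S. runs_forever (P @ C (length P) @ S) (length P, R))"

lemma exec_at:
  assumes "exec C R R'" "M = P @ C k @ S" "length P = k" "k' = k + length (C k)"
  shows "reach M (k, R) (k', R')"
  using assms unfolding exec_def by auto

lemma diverges_at:
  assumes "diverges C R" "M = P @ C k @ S" "length P = k"
  shows "runs_forever M (k, R)"
  using assms unfolding diverges_def by auto

text \<open>With nothing around it, the exit address of a fragment is the length of the program, so
  leaving the fragment is halting; determinism excludes any other output.\<close>

lemma exec_outputs:
  assumes "exec C (snd (initial p)) R"
  shows "outputs (C 0) p x \<longleftrightarrow> x = R 0"
proof -
  have "reach (C 0) (0, snd (initial p)) (length (C 0), R)"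
    by (rule exec_at[OF assms, of _ "[]" _ "[]"]) auto
  then have "reach (C 0) (initial p) (length (C 0), R)"
    by (simp add: initial_def)
  then have "outputs (C 0) p (R 0)"
    unfolding outputs_iff_reach by force
  then show ?thesis using outputs_functional by blast
qed

lemma diverges_outputs:
  assumes "diverges C (snd (initial p))"
  shows "\<not> outputs (C 0) p x"
proof -
  have "runs_forever (C 0) (0, snd (initial p))"
    by (rule diverges_at[OF assms, of _ "[]" _ "[]"]) auto
  then show ?thesis
    unfolding outputs_iff_reach runs_forever_def by (auto simp: initial_def)
qed

definition skip :: frag where
  "skip = (\<lambda>a. [])"

definition push :: "nat \<Rightarrow> bool \<Rightarrow> frag" where
  "push r b = (\<lambda>a. [Push r b])"

definition hang :: frag where
  "hang = (\<lambda>a. [Push 0 False, Pop 0 a a a])"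

definition seq :: "frag \<Rightarrow> frag \<Rightarrow> frag" (infixr \<open>;;\<close> 60) where
  "seq C D = (\<lambda>a. C a @ D (a + length (C a)))"

text \<open>Pops register \<open>r\<close> and runs \<open>B b\<close> for a popped bit \<open>b\<close>, or \<open>E\<close> if there is none. After
  \<open>B b\<close> control returns to the start if \<open>again\<close> holds and leaves the fragment otherwise.
  Pushing a bit and popping it at once serves as an unconditional jump.\<close>

definition branch :: "bool \<Rightarrow> nat \<Rightarrow> (bool \<Rightarrow> frag) \<Rightarrow> frag \<Rightarrow> frag" where
  "branch again r B E = (\<lambda>a.
     let c0 = B False (a + 1);
         a1 = a + length c0 + 3;
         c1 = B True a1;
         a2 = a1 + length c1 + 2;
         e = E a2;
         t = (if again then a else a2 + length e)
     in Pop r (a + 1) a1 a2 # c0 @ [Push r False, Pop r t t t] @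
        c1 @ [Push r False, Pop r t t t] @ e)"

abbreviation loop :: "nat \<Rightarrow> (bool \<Rightarrow> frag) \<Rightarrow> frag" where
  "loop r B \<equiv> branch True r B skip"

abbreviation cases :: "nat \<Rightarrow> (bool \<Rightarrow> frag) \<Rightarrow> frag \<Rightarrow> frag" where
  "cases \<equiv> branch False"

lemma exec_eq: "exec C R R' \<Longrightarrow> R' = R'' \<Longrightarrow> exec C R R''"
  by simp

lemma exec_skip: "exec skip R R"
  unfolding exec_def skip_def by (simp add: reach_refl)

lemma exec_push: "exec (push r b) R (R(r := b # R r))"
  unfolding exec_def push_def by (auto intro!: reach_Push[of _ _ _ r b] reach_refl)

lemma diverges_hang: "diverges hang R"
  unfolding diverges_def runs_forever_def
proof (intro allI impI)
  fix P S :: machine and d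
  let ?M = "P @ hang (length P) @ S"
  assume "reach ?M (length P, R) d"
  then obtain k where k: "(step ?M ^^ k) (length P, R) = d" unfolding reach_def by blast
  \<comment> \<open>The run alternates between two configurations, both with their address inside
    the fragment.\<close>
  have "(step ?M ^^ k) (length P, R) = (length P, R) \<or>
      (step ?M ^^ k) (length P, R) = (Suc (length P), R(0 := False # R 0))"
  proof (induction k)
    case (Suc k)
    have "step ?M (length P, R) = (Suc (length P), R(0 := False # R 0))"
      "step ?M (Suc (length P), R(0 := False # R 0)) = (length P, R)"
      by (simp_all add: hang_def nth_append)
    moreover have "(step ?M ^^ Suc k) (length P, R) = step ?M ((step ?M ^^ k) (length P, R))"
      by (simp del: step.simps)
    ultimately show ?case using Suc by metis
  qed simp
  then show "\<not> halted ?M d" using k by (auto simp: hang_def)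
qed

lemma exec_seq:
  assumes "exec C R R'" "exec D R' R''"
  shows "exec (C ;; D) R R''"
  unfolding exec_def
proof (intro allI)
  fix P S :: machine
  let ?a = "length P" let ?M = "P @ (C ;; D) ?a @ S"
  have "reach ?M (?a, R) (?a + length (C ?a), R')"
    by (rule exec_at[OF assms(1), of _ P _ "D (?a + length (C ?a)) @ S"]) (auto simp: seq_def)
  moreover have "reach ?M (?a + length (C ?a), R') (?a + length ((C ;; D) ?a), R'')"
    by (rule exec_at[OF assms(2), of _ "P @ C ?a" _ S]) (auto simp: seq_def)
  ultimately show "reach ?M (?a, R) (?a + length ((C ;; D) ?a), R'')"
    by (rule reach_trans)
qed

lemma seq_assoc: "(C ;; D) ;; E = C ;; D ;; E"
  by (simp add: seq_def fun_eq_iff add.assoc)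

lemma diverges_seq1:
  assumes "diverges C R"
  shows "diverges (C ;; D) R"
  unfolding diverges_def
proof (intro allI)
  fix P S :: machine
  let ?a = "length P"
  show "runs_forever (P @ (C ;; D) ?a @ S) (?a, R)"
    by (rule diverges_at[OF assms, of _ P _ "D (?a + length (C ?a)) @ S"]) (auto simp: seq_def)
qed

lemma diverges_seq2:
  assumes "exec C R R'" "diverges D R'"
  shows "diverges (C ;; D) R"
  unfolding diverges_def
proof (intro allI)
  fix P S :: machine
  let ?a = "length P" let ?M = "P @ (C ;; D) ?a @ S"
  have "reach ?M (?a, R) (?a + length (C ?a), R')"
    by (rule exec_at[OF assms(1), of _ P _ "D (?a + length (C ?a)) @ S"]) (auto simp: seq_def)
  moreover have "runs_forever ?M (?a + length (C ?a), R')"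
    by (rule diverges_at[OF assms(2), of _ "P @ C ?a" _ S]) (auto simp: seq_def)
  ultimately show "runs_forever ?M (?a, R)"
    by (rule reach_runs_forever)
qed

text \<open>Gathers the address arithmetic of \<open>branch\<close> in one place. In its definition
  the offset 3 counts the opening \<open>Pop\<close> and the two-instruction jump behind the first
  body, the offset 2 the jump behind the second.\<close>

lemma branch_layout:
  fixes P S :: machine and again r B E
  defines "a \<equiv> length P" and "M \<equiv> P @ branch again r B E (length P) @ S"
  defines "stop \<equiv> a + length (branch again r B E a)"
  defines "t \<equiv> if again then a else stop"
  shows "\<exists>k0 k1 k2. a < length M \<and> M ! a = Pop r k0 k1 k2 \<and>
    (\<forall>b. let k = (if b then k1 else k0); l = k + length (B b k) in
      (\<exists>P' S'. M = P' @ B b k @ S' \<and> length P' = k) \<and>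
      Suc l < length M \<and> M ! l = Push r False \<and> M ! Suc l = Pop r t t t) \<and>
    (\<exists>P'. M = P' @ E k2 @ S \<and> length P' = k2 \<and> stop = k2 + length (E k2))"
proof -
  define c0 where "c0 = B False (a + 1)"
  define k1 where "k1 = a + length c0 + 3"
  define c1 where "c1 = B True k1"
  define k2 where "k2 = k1 + length c1 + 2"
  define e where "e = E k2"
  have stop: "stop = k2 + length e"
    by (simp add: stop_def branch_def Let_def c0_def k1_def c1_def k2_def e_def)
  have M: "M = P @ Pop r (a + 1) k1 k2 # c0 @ [Push r False, Pop r t t t] @
        c1 @ [Push r False, Pop r t t t] @ e @ S"
    by (simp add: M_def branch_def Let_def t_def stop c0_def k1_def c1_def k2_def e_def a_def)
  have M0: "M = (P @ [Pop r (a + 1) k1 k2]) @ B False (a + 1) @ ([Push r False, Pop r t t t] @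
        c1 @ [Push r False, Pop r t t t] @ e @ S)"
    unfolding M c0_def by simp
  have M1: "M = (P @ Pop r (a + 1) k1 k2 # c0 @ [Push r False, Pop r t t t]) @
      B True k1 @ ([Push r False, Pop r t t t] @ e @ S)"
    unfolding M c1_def by simp
  have M2: "M = (P @ Pop r (a + 1) k1 k2 # c0 @ [Push r False, Pop r t t t] @ c1 @
      [Push r False, Pop r t t t]) @ E k2 @ S"
    unfolding M e_def by simp
  have at: "(xs @ y # z # zs) ! n = y" "(xs @ y # z # zs) ! Suc n = z"
    if "length xs = n" for xs zs and y z :: instr and n
    using that by (auto simp: nth_append)
  have body: "\<exists>P' S'. M = P' @ B b k @ S' \<and> length P' = k"
    "Suc l < length M" "M ! l = Push r False" "M ! Suc l = Pop r t t t"
    if "k = (if b then k1 else a + 1)" "l = k + length (B b k)" for b k l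
  proof -
    show "\<exists>P' S'. M = P' @ B b k @ S' \<and> length P' = k"
    proof (cases b)
      case True
      have "length (P @ Pop r (a + 1) k1 k2 # c0 @ [Push r False, Pop r t t t]) = k"
        using that True by (simp add: k1_def a_def)
      then show ?thesis using M1 that True by metis
    next
      case False
      have "length (P @ [Pop r (a + 1) k1 k2]) = k" using that False by (simp add: a_def)
      then show ?thesis using M0 that False by metis
    qed
    show "Suc l < length M"
      unfolding M using that by (auto simp: a_def k1_def c0_def c1_def)
    have "M = (P @ Pop r (a + 1) k1 k2 # c0) @ Push r False # Pop r t t t #
        (c1 @ [Push r False, Pop r t t t] @ e @ S)"
      "M = (P @ Pop r (a + 1) k1 k2 # c0 @ [Push r False, Pop r t t t] @ c1) @
        Push r False # Pop r t t t # (e @ S)"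
      unfolding M by simp_all
    moreover have "length (P @ Pop r (a + 1) k1 k2 # c0) = l" if "\<not> b"
      using that \<open>k = _\<close> \<open>l = _\<close> by (simp add: a_def c0_def)
    moreover have "length (P @ Pop r (a + 1) k1 k2 # c0 @ [Push r False, Pop r t t t] @ c1) = l" if b
      using that \<open>k = _\<close> \<open>l = _\<close> by (simp add: a_def k1_def c1_def)
    ultimately show "M ! l = Push r False" "M ! Suc l = Pop r t t t"
      using at by (cases b; metis)+
  qed
  have "length (P @ Pop r (a + 1) k1 k2 # c0 @ [Push r False, Pop r t t t] @ c1 @
      [Push r False, Pop r t t t]) = k2"
    by (simp add: k2_def k1_def a_def)
  then have "\<exists>P'. M = P' @ E k2 @ S \<and> length P' = k2 \<and> stop = k2 + length (E k2)"
    using M2 stop unfolding e_def by metis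
  moreover have "a < length M" "M ! a = Pop r (a + 1) k1 k2"
    unfolding M by (simp_all add: a_def nth_append)
  moreover have "\<forall>b. let k = (if b then k1 else a + 1); l = k + length (B b k) in
      (\<exists>P' S'. M = P' @ B b k @ S' \<and> length P' = k) \<and>
      Suc l < length M \<and> M ! l = Push r False \<and> M ! Suc l = Pop r t t t"
    unfolding Let_def by (intro allI conjI body[OF refl refl])
  ultimately show ?thesis
    by (intro exI[of _ "a + 1"] exI[of _ k1] exI[of _ k2] conjI)
qed

text \<open>Stated with \<open>reach\<close> instead of \<open>exec\<close>, because a round of a
  loop ends at its start and not behind the fragment; this way one lemma serves both
  \<open>loop\<close> and \<open>cases\<close>.\<close>

lemma reach_branch_Cons:
  fixes P S :: machine and again E
  assumes "R r = b # w" "exec (B b) (R(r := w)) R'"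
  defines "M \<equiv> P @ branch again r B E (length P) @ S"
  shows "reach M (length P, R)
    (if again then length P else length P + length (branch again r B E (length P)), R')"
  (is "reach M _ (?t, _)")
proof -
  obtain k0 k1 k2 where L: "length P < length M" "M ! length P = Pop r k0 k1 k2"
    "\<forall>b. let k = (if b then k1 else k0); l = k + length (B b k) in
      (\<exists>P' S'. M = P' @ B b k @ S' \<and> length P' = k) \<and>
      Suc l < length M \<and> M ! l = Push r False \<and> M ! Suc l = Pop r ?t ?t ?t"
    using branch_layout[of P again r B E S] unfolding M_def by blast
  define k where "k = (if b then k1 else k0)"
  obtain P' S' where B: "M = P' @ B b k @ S'" "length P' = k"
    "Suc (k + length (B b k)) < length M" "M ! (k + length (B b k)) = Push r False"
    "M ! Suc (k + length (B b k)) = Pop r ?t ?t ?t"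
    using L(3) unfolding Let_def k_def by blast
  have "reach M (k, R(r := w)) (k + length (B b k), R')"
    by (rule exec_at[OF assms(2) B(1,2) refl])
  then have "reach M (length P, R) (k + length (B b k), R')"
    unfolding k_def using L(1,2) assms(1) by - (rule reach_Pop_Cons[of _ b], auto)
  moreover have "reach M (k + length (B b k), R') (?t, R')"
    by (rule reach_jump[OF reach_refl B(3-5)])
  ultimately show ?thesis by (rule reach_trans)
qed

lemma exec_branch_Nil:
  assumes "R r = []" "exec E R R'"
  shows "exec (branch again r B E) R R'"
  unfolding exec_def
proof (intro allI)
  fix P S :: machine
  let ?M = "P @ branch again r B E (length P) @ S"
  obtain k0 k1 k2 P' where L: "length P < length ?M" "?M ! length P = Pop r k0 k1 k2"
    "?M = P' @ E k2 @ S" "length P' = k2"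
    "length P + length (branch again r B E (length P)) = k2 + length (E k2)"
    using branch_layout[of P again r B E S] by blast
  have "reach ?M (k2, R) (length P + length (branch again r B E (length P)), R')"
    by (rule exec_at[OF assms(2) L(3-5)])
  then show "reach ?M (length P, R) (length P + length (branch again r B E (length P)), R')"
    using L(1,2) assms(1) by - (rule reach_Pop_Nil[of _ k2], auto)
qed

lemma exec_cases_Cons:
  assumes "R r = b # w" "exec (B b) (R(r := w)) R'"
  shows "exec (cases r B E) R R'"
  unfolding exec_def using reach_branch_Cons[of R r b w B R', OF assms, of _ False] by auto

lemma exec_loop_Cons:
  assumes "R r = b # w" "exec (B b) (R(r := w)) R'" "exec (loop r B) R' R''"
  shows "exec (loop r B) R R''"
  unfolding exec_def
proof (intro allI)
  fix P S :: machine
  let ?M = "P @ loop r B (length P) @ S"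
  have "reach ?M (length P, R) (length P, R')"
    using reach_branch_Cons[of R r b w B R', OF assms(1,2), of P True] by simp
  moreover have "reach ?M (length P, R') (length P + length (loop r B (length P)), R'')"
    using assms(3) unfolding exec_def by blast
  ultimately show "reach ?M (length P, R) (length P + length (loop r B (length P)), R'')"
    by (rule reach_trans)
qed

lemma exec_loop_Nil: "R r = [] \<Longrightarrow> exec (loop r B) R R"
  by (rule exec_branch_Nil) (simp_all add: exec_skip)

lemma diverges_branch_Cons:
  assumes "R r = b # w" "diverges (B b) (R(r := w))"
  shows "diverges (branch again r B E) R"
  unfolding diverges_def
proof (intro allI)
  fix P S :: machine
  let ?M = "P @ branch again r B E (length P) @ S"
  obtain k0 k1 k2 where L: "length P < length ?M" "?M ! length P = Pop r k0 k1 k2"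
    "\<forall>b. let k = (if b then k1 else k0) in
      (\<exists>P' S'. ?M = P' @ B b k @ S' \<and> length P' = k)"
    using branch_layout[of P again r B E S] unfolding Let_def by blast
  define k where "k = (if b then k1 else k0)"
  obtain P' S' where B: "?M = P' @ B b k @ S'" "length P' = k"
    using L(3) unfolding Let_def k_def by blast
  have "runs_forever ?M (k, R(r := w))"
    by (rule diverges_at[OF assms(2) B])
  moreover have "reach ?M (length P, R) (k, R(r := w))"
    unfolding k_def using L(1,2) assms(1) by - (rule reach_Pop_Cons[OF reach_refl], auto)
  ultimately show "runs_forever ?M (length P, R)" by (rule reach_runs_forever[rotated])
qed

lemma diverges_branch_Nil:
  assumes "R r = []" "diverges E R"
  shows "diverges (branch again r B E) R"
  unfolding diverges_def
proof (intro allI)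
  fix P S :: machine
  let ?M = "P @ branch again r B E (length P) @ S"
  obtain k0 k1 k2 P' where L: "length P < length ?M" "?M ! length P = Pop r k0 k1 k2"
    "?M = P' @ E k2 @ S" "length P' = k2"
    using branch_layout[of P again r B E S] by blast
  have "runs_forever ?M (k2, R)"
    by (rule diverges_at[OF assms(2) L(3,4)])
  moreover have "reach ?M (length P, R) (k2, R)"
    using L(1,2) assms(1) by - (rule reach_Pop_Nil[OF reach_refl], auto)
  ultimately show "runs_forever ?M (length P, R)" by (rule reach_runs_forever[rotated])
qed

lemma diverges_loop_Cons:
  assumes "R r = b # w" "exec (B b) (R(r := w)) R'" "diverges (loop r B) R'"
  shows "diverges (loop r B) R"
  unfolding diverges_def
proof (intro allI)
  fix P S :: machine
  let ?M = "P @ loop r B (length P) @ S"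
  have "reach ?M (length P, R) (length P, R')"
    using reach_branch_Cons[of R r b w B R', OF assms(1,2), of P True] by simp
  moreover have "runs_forever ?M (length P, R')"
    using assms(3) unfolding diverges_def by blast
  ultimately show "runs_forever ?M (length P, R)" by (rule reach_runs_forever)
qed

section \<open>Programs for the string and number encodings\<close>

definition pour :: "nat \<Rightarrow> nat \<Rightarrow> frag" where
  "pour r s = loop r (push s)"

text \<open>Moving a stack bit by bit reverses it. Later programs either undo this by a second
  transfer or rely on it.\<close>

lemma exec_pour:
  "r \<noteq> s \<Longrightarrow> exec (pour r s) R (R(r := [], s := rev (R r) @ R s))"
proof (induction "R r" arbitrary: R)
  case Nil
  then have "exec (pour r s) R R" unfolding pour_def by (intro exec_loop_Nil) simp
  then show ?case by (rule exec_eq) (use Nil in \<open>auto simp: fun_eq_iff\<close>)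
next
  case (Cons b w)
  let ?R = "R(r := w, s := b # R s)"
  have "exec (push s b) (R(r := w)) ?R"
    using exec_push[of s b "R(r := w)"] Cons(3) by simp
  then have "exec (pour r s) R (?R(r := [], s := rev (?R r) @ ?R s))"
    unfolding pour_def using Cons(2) Cons(1)[of ?R] Cons(3)
    by (intro exec_loop_Cons[of R r b w]) (auto simp: pour_def)
  then show ?case
    by (rule exec_eq) (use Cons(2,3) in \<open>auto simp: fun_eq_iff simp flip: Cons(2)\<close>)
qed

text \<open>Reading a register empties it. The content therefore goes to the auxiliary register
  \<open>t\<close> and returns from there to \<open>r\<close> and \<open>d\<close> at once, which
  also restores the order.\<close>

definition copy :: "nat \<Rightarrow> nat \<Rightarrow> nat \<Rightarrow> frag" where
  "copy r t d = pour r t ;; loop t (\<lambda>b. push r b ;; push d b)"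

lemma exec_copy:
  assumes "distinct [r, t, d]" "R t = []"
  shows "exec (copy r t d) R (R(d := R r @ R d))"
proof -
  have loop: "exec (loop t (\<lambda>b. push r b ;; push d b)) R
      (R(t := [], r := rev (R t) @ R r, d := rev (R t) @ R d))" for R
  proof (induction "R t" arbitrary: R)
    case Nil
    then show ?case by (intro exec_eq[OF exec_loop_Nil]) auto
  next
    case (Cons b w)
    let ?R = "R(t := w, r := b # R r, d := b # R d)"
    have "exec (push r b ;; push d b) (R(t := w)) ?R"
      by (rule exec_eq[OF exec_seq[OF exec_push exec_push]]) (use assms in auto)
    then show ?case
      by (rule exec_eq[OF exec_loop_Cons[of R t b w, OF Cons(2)[symmetric] _ Cons(1)]])
        (use assms Cons(2) in \<open>auto simp: fun_eq_iff simp flip: Cons(2)\<close>)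
  qed
  show ?thesis unfolding copy_def
    by (rule exec_eq[OF exec_seq[OF exec_pour loop]]) (use assms in \<open>auto simp: fun_eq_iff\<close>)
qed

section \<open>Conversion between strings and unary numerals\<close>

abbreviation unary :: "nat \<Rightarrow> str" where
  "unary n \<equiv> replicate n True"

text \<open>Horner's rule for \<open>num_of_str\<close>: for each bit the numeral in
  \<open>d\<close> is doubled by way of \<open>t\<close> and increased by 1 or 2.\<close>

definition to_unary :: "nat \<Rightarrow> nat \<Rightarrow> nat \<Rightarrow> frag" where
  "to_unary r d t = loop r (\<lambda>b. loop d (\<lambda>_. push t True ;; push t True) ;; pour t d ;;
     push d True ;; (if b then push d True else skip))"

lemma exec_to_unary:
  assumes "distinct [r, d, t]" "R d = []" "R t = []"
  shows "exec (to_unary r d t) R (R(r := [], d := unary (num_of_str (R r))))"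
proof -
  have double: "exec (loop d (\<lambda>_. push t True ;; push t True)) R
      (R(d := [], t := unary (2 * length (R d)) @ R t))" for R
  proof (induction "R d" arbitrary: R)
    case Nil
    then show ?case by (intro exec_eq[OF exec_loop_Nil]) auto
  next
    case (Cons b w)
    let ?R = "R(d := w, t := True # True # R t)"
    have "exec (push t True ;; push t True) (R(d := w)) ?R"
      by (rule exec_eq[OF exec_seq[OF exec_push exec_push]]) (use assms in auto)
    then show ?case
      by (rule exec_eq[OF exec_loop_Cons[of R d b w, OF Cons(2)[symmetric] _ Cons(1)]])
        (use assms Cons(2) in \<open>auto simp: fun_eq_iff replicate_app_Cons_same simp flip: Cons(2)\<close>)
  qed
  \<comment> \<open>Generalised from an empty \<open>d\<close> to an arbitrary numeral there, which
    is the accumulator of the fold.\<close>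
  have "exec (to_unary r d t) R
      (R(r := [], d := unary (foldl (\<lambda>n b. 2 * n + (if b then 2 else 1)) n (R r))))"
    if "R d = unary n" "R t = []" for R n
    using that
  proof (induction "R r" arbitrary: R n)
    case Nil
    then show ?case unfolding to_unary_def by (intro exec_eq[OF exec_loop_Nil]) auto
  next
    case (Cons b w)
    let ?n = "2 * n + (if b then 2 else 1)"
    let ?R = "R(r := w, d := unary ?n)"
    have "exec (loop d (\<lambda>_. push t True ;; push t True) ;; pour t d ;; push d True)
        (R(r := w)) (R(r := w, d := unary (2 * n + 1)))"
      by (rule exec_eq[OF exec_seq[OF double exec_seq[OF exec_pour exec_push]]])
        (use assms Cons in \<open>auto simp: fun_eq_iff\<close>)
    moreover have "exec (if b then push d True else skip) (R(r := w, d := unary (2 * n + 1))) ?R"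
      using exec_push[of d True "R(r := w, d := unary (2 * n + 1))"] exec_skip by simp
    ultimately have "exec (loop d (\<lambda>_. push t True ;; push t True) ;; pour t d ;; push d True ;;
        (if b then push d True else skip)) (R(r := w)) ?R"
      by (simp add: exec_seq seq_assoc[symmetric])
    then show ?case unfolding to_unary_def
      by (rule exec_eq[OF exec_loop_Cons[of R r b w, OF Cons(2)[symmetric] _ Cons(1)[unfolded to_unary_def]]])
        (use assms Cons in \<open>auto simp: fun_eq_iff simp flip: Cons(2)\<close>)
  qed
  from this[of R 0] show ?thesis using assms by (simp add: num_of_str_def)
qed

text \<open>Successor in bijective base 2 with \<open>False\<close> as digit 1 and
  \<open>True\<close> as digit 2, least significant digit at the head. A digit 2 turns into 1 and
  passes a carry on; a carry beyond the last digit becomes a new digit 1.\<close>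

fun incr :: "str \<Rightarrow> str" where
  "incr [] = [False]"
| "incr (False # v) = True # v"
| "incr (True # v) = False # incr v"

lemma num_of_str_incr: "num_of_str (rev (incr v)) = Suc (num_of_str (rev v))"
  by (induction v rule: incr.induct) (simp_all add: num_of_str_def)

text \<open>Register \<open>g\<close> is nonempty as long as a carry is pending, and
  \<open>t\<close> keeps the digits that the carry has already passed.\<close>

definition increment :: "nat \<Rightarrow> nat \<Rightarrow> nat \<Rightarrow> frag" where
  "increment v g t = push g True ;;
     loop g (\<lambda>_. cases v
       (\<lambda>b. if b then push t False ;; push g True else push v True) (push v False)) ;;
     pour t v"

lemma exec_increment:
  assumes "distinct [v, g, t]" "R g = []" "R t = []"
  shows "exec (increment v g t) R (R(v := incr (R v)))"
proof -
  let ?B = "\<lambda>_. cases v (\<lambda>b. if b then push t False ;; push g True else push v True) (push v False)"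
  \<comment> \<open>\<open>u\<close> consists of the digits set aside in \<open>t\<close>, in
    reverse order, and \<open>w\<close> is what remains in \<open>v\<close> once the carry is
    absorbed.\<close>
  have loop: "\<exists>w u. rev u @ w = incr (R v) \<and>
      exec (loop g ?B) R (R(v := w, t := u @ R t, g := []))" if "R g = [True]" for R
    using that
  proof (induction "R v" arbitrary: R rule: incr.induct)
    case 1
    have "exec (loop g ?B) R (R(v := [False], t := [] @ R t, g := []))"
      by (rule exec_eq[OF exec_loop_Cons[OF _ exec_branch_Nil[OF _ exec_push] exec_loop_Nil]])
        (use 1 assms in auto)
    then show ?case
      by - (rule exI[of _ "[False]"], rule exI[of _ "[]"], simp add: fun_upd_def 1(1)[symmetric])
  next
    case (2 w)
    have "exec (push v True) (R(g := [], v := w)) (R(g := [], v := True # w))"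
      by (rule exec_eq[OF exec_push]) simp
    then have body: "exec (?B True) (R(g := [])) (R(g := [], v := True # w))"
      by (intro exec_cases_Cons[of _ _ False w]) (use assms 2 in auto)
    have "exec (loop g ?B) R (R(v := True # w, t := [] @ R t, g := []))"
      by (rule exec_eq[OF exec_loop_Cons[of R g True "[]" ?B, OF 2(2) body exec_loop_Nil]])
        (use assms 2 in \<open>auto simp: fun_eq_iff\<close>)
    then show ?case
      by - (rule exI[of _ "True # w"], rule exI[of _ "[]"], simp add: fun_upd_def 2(1)[symmetric])
  next
    case (3 w)
    let ?R = "R(v := w, t := False # R t)"
    have "exec (push t False ;; push g True) (R(g := [], v := w)) ?R"
      by (rule exec_eq[OF exec_seq[OF exec_push exec_push]])
        (use assms 3 in \<open>auto simp: fun_eq_iff\<close>)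
    then have body: "exec (?B True) (R(g := [])) ?R"
      by (intro exec_cases_Cons[of _ _ True w]) (use assms 3 in auto)
    obtain w' u where u: "rev u @ w' = incr w"
      "exec (loop g ?B) ?R (?R(v := w', t := u @ ?R t, g := []))"
      using 3(1)[of ?R] 3(3) assms by auto
    have "exec (loop g ?B) R (R(v := w', t := (u @ [False]) @ R t, g := []))"
      by (rule exec_eq[OF exec_loop_Cons[OF _ body u(2)]])
        (use assms 3 in \<open>auto simp: fun_eq_iff\<close>)
    then show ?case using u(1)
      by - (rule exI[of _ w'], rule exI[of _ "u @ [False]"], simp flip: 3(2))
  qed
  obtain w u where "rev u @ w = incr (R v)"
    "exec (loop g ?B) (R(g := [True])) (R(g := [True], v := w, t := u @ R t, g := []))"
    using loop[of "R(g := [True])"] assms by auto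
  then show ?thesis unfolding increment_def
    by (intro exec_eq[OF exec_seq[OF exec_eq[OF exec_push] exec_seq[OF _ exec_pour]]])
      (use assms in \<open>auto simp: fun_eq_iff\<close>)
qed

definition from_unary :: "nat \<Rightarrow> nat \<Rightarrow> nat \<Rightarrow> nat \<Rightarrow> nat \<Rightarrow> frag" where
  "from_unary c v g t d = loop c (\<lambda>_. increment v g t) ;; pour v d"

lemma exec_from_unary:
  assumes "distinct [c, v, g, t, d]" "R v = []" "R g = []" "R t = []" "R d = []"
  shows "exec (from_unary c v g t d) R (R(c := [], d := str_of_num (length (R c))))"
proof -
  \<comment> \<open>Generalised to any start value in \<open>v\<close>. The string stands there
    reversed, because \<open>incr\<close> works from the least significant digit; the final
    \<open>pour\<close> turns it round.\<close>
  have "exec (loop c (\<lambda>_. increment v g t)) R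
      (R(c := [], v := rev (str_of_num (num_of_str (rev (R v)) + length (R c)))))"
    if "R g = []" "R t = []" for R
    using that
  proof (induction "R c" arbitrary: R)
    case Nil
    then show ?case by (intro exec_eq[OF exec_loop_Nil]) auto
  next
    case (Cons b w)
    show ?case
      by (rule exec_eq[OF exec_loop_Cons[of R c b w "\<lambda>_. increment v g t", OF Cons(2)[symmetric] exec_increment Cons(1)]])
        (use assms Cons in \<open>auto simp: fun_eq_iff num_of_str_incr simp flip: Cons(2)
           simp del: str_of_num.simps\<close>)
  qed
  then show ?thesis unfolding from_unary_def
    by (rule exec_eq[OF exec_seq[OF _ exec_pour]])
      (use assms in \<open>auto simp: fun_eq_iff num_of_str_def\<close>)
qed

section \<open>The Cantor pairing function in unary\<close>

text \<open>Both pairing programs walk along the enumeration of pairs behind \<open>prod_encode\<close>, in which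
  \<open>(i + 1, j)\<close> is preceded by \<open>(i, j + 1)\<close>, and \<open>(0, j + 1)\<close> by \<open>(j, 0)\<close>.\<close>

lemma prod_encode_Suc_left: "prod_encode (Suc i, j) = Suc (prod_encode (i, Suc j))"
  by (simp add: prod_encode_def)

lemma prod_encode_0_Suc: "prod_encode (0, Suc j) = Suc (prod_encode (j, 0))"
  by (simp add: prod_encode_def)

text \<open>Walks backwards to (0, 0) and adds one bit to \<open>d\<close> per step. The flag
  \<open>g\<close> is set again exactly when the current pair has a predecessor.\<close>

definition encode_pair :: "nat \<Rightarrow> nat \<Rightarrow> nat \<Rightarrow> nat \<Rightarrow> frag" where
  "encode_pair m n d g = push g True ;;
     loop g (\<lambda>_. cases m (\<lambda>_. push n True ;; push d True ;; push g True)
       (cases n (\<lambda>b. pour n m ;; push d True ;; push g True) skip))"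

lemma exec_encode_pair:
  assumes "distinct [m, n, d, g]" "R m = unary i" "R n = unary j" "R g = []"
  shows "exec (encode_pair m n d g) R (R(m := [], n := [], d := unary (prod_encode (i, j)) @ R d))"
proof -
  let ?B = "\<lambda>_. cases m (\<lambda>_. push n True ;; push d True ;; push g True)
       (cases n (\<lambda>b. pour n m ;; push d True ;; push g True) skip)"
  have loop: "exec (loop g ?B) R
      (R(m := [], n := [], g := [], d := unary (prod_encode (i, j)) @ R d))"
    if "R m = unary i" "R n = unary j" "R g = [True]" for R i j
    using that
  proof (induction "prod_encode (i, j)" arbitrary: R i j)
    case 0
    then have "i = 0" "j = 0"
      using prod_encode_eq[of "(i, j)" "(0, 0)"] by (auto simp: prod_encode_def)
    then show ?case
      by (intro exec_eq[OF exec_loop_Cons[of R g True "[]" ?B,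
              OF _ exec_branch_Nil[OF _ exec_branch_Nil[OF _ exec_skip]] exec_loop_Nil]])
        (use assms 0 in \<open>auto simp: fun_eq_iff prod_encode_def\<close>)
  next
    case (Suc k)
    show ?case
    proof (cases i)
      case i: (Suc i')
      let ?R = "R(m := unary i', n := unary (Suc j), d := True # R d)"
      have "exec (push n True ;; push d True ;; push g True) (R(g := [], m := unary i')) ?R"
        by (rule exec_eq[OF exec_seq[OF exec_push exec_seq[OF exec_push exec_push]]])
          (use assms Suc in \<open>auto simp: fun_eq_iff\<close>)
      then have body: "exec (?B True) (R(g := [])) ?R"
        by (intro exec_cases_Cons[of _ _ True "unary i'"]) (use assms Suc i in auto)
      have k: "k = prod_encode (i', Suc j)"
        using Suc(2) i by (simp add: prod_encode_Suc_left)
      have "exec (loop g ?B) ?R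
          (?R(m := [], n := [], g := [], d := unary (prod_encode (i', Suc j)) @ ?R d))"
        by (rule Suc(1)[OF k]) (use assms Suc in auto)
      from exec_loop_Cons[of R g True "[]" ?B, OF Suc(5) body this] show ?thesis
        by (rule exec_eq) (use assms i in
          \<open>auto simp: fun_eq_iff prod_encode_Suc_left replicate_app_Cons_same\<close>)
    next
      case i: 0
      have "j \<noteq> 0" using Suc(2) i by (intro notI) (simp add: prod_encode_def)
      then obtain j' where j: "j = Suc j'" by (cases j) auto
      let ?R = "R(m := unary j', n := [], d := True # R d)"
      have "exec (pour n m ;; push d True ;; push g True) (R(g := [], n := unary j')) ?R"
        by (rule exec_eq[OF exec_seq[OF exec_pour exec_seq[OF exec_push exec_push]]])
          (use assms Suc i in \<open>auto simp: fun_eq_iff\<close>)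
      then have body: "exec (?B True) (R(g := [])) ?R"
        by (intro exec_branch_Nil exec_cases_Cons[of _ _ True "unary j'"])
          (use assms Suc i j in auto)
      have k: "k = prod_encode (j', 0)"
        using Suc(2) i j by (simp add: prod_encode_0_Suc)
      have "exec (loop g ?B) ?R
          (?R(m := [], n := [], g := [], d := unary (prod_encode (j', 0)) @ ?R d))"
        by (rule Suc(1)[OF k]) (use assms Suc in auto)
      from exec_loop_Cons[of R g True "[]" ?B, OF Suc(5) body this] show ?thesis
        by (rule exec_eq) (use assms i j in
          \<open>auto simp: fun_eq_iff prod_encode_0_Suc replicate_app_Cons_same\<close>)
    qed
  qed
  show ?thesis unfolding encode_pair_def
    by (rule exec_eq[OF exec_seq[OF exec_push loop]]) (use assms in \<open>auto simp: fun_eq_iff\<close>)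
qed

definition decode_pair :: "nat \<Rightarrow> nat \<Rightarrow> nat \<Rightarrow> frag" where
  "decode_pair c m n = loop c (\<lambda>_. cases n (\<lambda>_. push m True) (pour m n ;; push n True))"

lemma exec_decode_pair:
  assumes "distinct [c, m, n]" "R m = []" "R n = []" "prod_decode (length (R c)) = (i, j)"
  shows "exec (decode_pair c m n) R (R(c := [], m := unary i, n := unary j))"
proof -
  let ?B = "\<lambda>_. cases n (\<lambda>_. push m True) (pour m n ;; push n True)"
  \<comment> \<open>Invariant of the forward walk: the code of the current pair plus the number of
    steps still to go is the code of the target.\<close>
  have "exec (loop c ?B) R (R(c := [], m := unary i, n := unary j))"
    if "R m = unary i'" "R n = unary j'" "prod_encode (i, j) = prod_encode (i', j') + length (R c)"
    for R i' j'
    using that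
  proof (induction "R c" arbitrary: R i' j')
    case Nil
    then have "(i, j) = (i', j')" using prod_encode_eq by (metis add_0_right list.size(3))
    then show ?case using Nil by (intro exec_eq[OF exec_loop_Nil]) auto
  next
    case (Cons b w)
    show ?case
    proof (cases j')
      case 0
      let ?R = "R(c := w, m := [], n := unary (Suc i'))"
      have "exec (pour m n ;; push n True) (R(c := w)) ?R"
        by (rule exec_eq[OF exec_seq[OF exec_pour exec_push]])
          (use assms Cons 0 in \<open>auto simp: fun_eq_iff\<close>)
      then have body: "exec (?B b) (R(c := w)) ?R"
        by (intro exec_branch_Nil) (use assms Cons 0 in auto)
      have "exec (loop c ?B) ?R (?R(c := [], m := unary i, n := unary j))"
        by (rule Cons(1)[of _ 0 "Suc i'"])
          (use assms Cons 0 in \<open>auto simp: prod_encode_0_Suc simp flip: Cons(2)\<close>)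
      from exec_loop_Cons[of R c b w ?B, OF Cons(2)[symmetric] body this] show ?thesis
        by (rule exec_eq) (use assms in \<open>auto simp: fun_eq_iff\<close>)
    next
      case (Suc j'')
      let ?R = "R(c := w, n := unary j'', m := unary (Suc i'))"
      have "exec (push m True) (R(c := w, n := unary j'')) ?R"
        by (rule exec_eq[OF exec_push]) (use assms Cons in \<open>auto simp: fun_eq_iff\<close>)
      then have body: "exec (?B b) (R(c := w)) ?R"
        by (intro exec_cases_Cons[of _ _ True "unary j''"]) (use assms Cons Suc in auto)
      have "exec (loop c ?B) ?R (?R(c := [], m := unary i, n := unary j))"
        by (rule Cons(1)[of _ "Suc i'" j''])
          (use assms Cons Suc in \<open>auto simp: prod_encode_Suc_left simp flip: Cons(2)\<close>)
      from exec_loop_Cons[of R c b w ?B, OF Cons(2)[symmetric] body this] show ?thesis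
        by (rule exec_eq) (use assms in \<open>auto simp: fun_eq_iff\<close>)
    qed
  qed
  \<comment> \<open>The walk starts at (0, 0), whose code is 0, so the whole counter remains to be
    consumed.\<close>
  moreover have "prod_encode (i, j) = length (R c)" using assms(4) by (metis prod_decode_inverse)
  ultimately show ?thesis
    using assms unfolding decode_pair_def by (auto simp: prod_encode_def)
qed

definition truncate :: "nat \<Rightarrow> nat \<Rightarrow> nat \<Rightarrow> frag" where
  "truncate y n t = loop n (\<lambda>_. cases y (push t) skip) ;; loop y (\<lambda>_. skip) ;; pour t y"

lemma exec_truncate:
  assumes "distinct [y, n, t]" "R t = []"
  shows "exec (truncate y n t) R (R(n := [], y := take (length (R n)) (R y)))"
proof -
  let ?B = "\<lambda>_. cases y (push t) skip"
  have take: "exec (loop n ?B) R (R(n := [], t := rev (take (length (R n)) (R y)) @ R t,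
      y := drop (length (R n)) (R y)))" for R
  proof (induction "R n" arbitrary: R)
    case Nil
    then show ?case by (intro exec_eq[OF exec_loop_Nil]) auto
  next
    case (Cons b w)
    show ?case
    proof (cases "R y")
      case Nil
      have body: "exec (?B b) (R(n := w)) (R(n := w))"
        by (rule exec_branch_Nil[OF _ exec_skip]) (use assms Nil in auto)
      show ?thesis
        by (rule exec_eq[OF exec_loop_Cons[of R n b w ?B, OF Cons(2)[symmetric] body Cons(1)]])
          (use assms Nil in \<open>auto simp: fun_eq_iff\<close>)
    next
      case y: (Cons a v)
      let ?R = "R(n := w, y := v, t := a # R t)"
      have "exec (push t a) (R(n := w, y := v)) ?R"
        by (rule exec_eq[OF exec_push]) (use assms in auto)
      then have body: "exec (?B b) (R(n := w)) ?R"
        by (intro exec_cases_Cons[of _ _ a v]) (use assms y in auto)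
      show ?thesis
        by (rule exec_eq[OF exec_loop_Cons[of R n b w ?B, OF Cons(2)[symmetric] body Cons(1)]])
          (use assms y in \<open>auto simp: fun_eq_iff simp flip: Cons(2)\<close>)
    qed
  qed
  have clear: "exec (loop y (\<lambda>_. skip)) R (R(y := []))" for R
  proof (induction "R y" arbitrary: R)
    case Nil
    then show ?case by (intro exec_eq[OF exec_loop_Nil]) auto
  next
    case (Cons b w)
    show ?case
      by (rule exec_eq[OF exec_loop_Cons[of R y b w "\<lambda>_. skip", OF Cons(2)[symmetric]
              exec_skip Cons(1)]]) auto
  qed
  show ?thesis unfolding truncate_def
    by (rule exec_eq[OF exec_seq[OF take exec_seq[OF clear exec_pour]]])
      (use assms in \<open>auto simp: fun_eq_iff\<close>)
qed

section \<open>Step-counting simulation\<close>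

fun register :: "instr \<Rightarrow> nat" where
  "register (Push r b) = r"
| "register (Pop r k0 k1 ke) = r"

fun relocate :: "(nat \<Rightarrow> nat) \<Rightarrow> instr \<Rightarrow> instr" where
  "relocate f (Push r b) = Push r b"
| "relocate f (Pop r k0 k1 ke) = Pop r (f k0) (f k1) (f ke)"

text \<open>Every instruction of \<open>U\<close> is preceded by one that adds a bit to the counter \<open>c\<close>.\<close>

definition simulate :: "machine \<Rightarrow> nat \<Rightarrow> frag" where
  "simulate U c = (\<lambda>a. map (\<lambda>j. if even j then Push c True
     else relocate (\<lambda>k. a + 2 * min k (length U)) (U ! (j div 2))) [0..<2 * length U])"

text \<open>Separates the registers of the simulated machine, all below \<open>N\<close>, from those
  of the surrounding program, so that each half can be described without the other.\<close>

definition overlay :: "nat \<Rightarrow> regs \<Rightarrow> regs \<Rightarrow> regs" where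
  "overlay N R S = (\<lambda>r. if r < N then R r else S r)"

text \<open>One step of \<open>U\<close> costs two steps here: the push onto the counter and the
  relocated instruction. \<open>U\<close> may halt at any address beyond its end; \<open>min\<close>
  sends all of them to the exit of the fragment.\<close>

lemma step_simulate:
  assumes U: "\<forall>i\<in>set U. register i < N" "N \<le> c"
    and pc: "pc < length U" and M: "M = P @ simulate U c (length P) @ Q"
    and step: "step U (pc, R) = (pc', R')"
  shows "(step M ^^ 2) (length P + 2 * pc, overlay N R S) =
    (length P + 2 * min pc' (length U), overlay N R' (S(c := True # S c)))"
proof -
  let ?a = "length P" let ?f = "\<lambda>k. ?a + 2 * min k (length U)"
  have len: "length M \<ge> ?a + 2 * length U" unfolding M simulate_def by simp
  have nth: "M ! (?a + j) = simulate U c ?a ! j" if "j < 2 * length U" for j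
    unfolding M using that by (simp add: nth_append simulate_def)
  have "M ! (?a + 2 * pc) = Push c True"
    using nth[of "2 * pc"] pc by (simp add: simulate_def)
  then have 1: "step M (?a + 2 * pc, overlay N R S) =
      (Suc (?a + 2 * pc), overlay N R (S(c := True # S c)))"
    using len pc U(2) by (auto simp: overlay_def fun_eq_iff)
  have at: "M ! Suc (?a + 2 * pc) = relocate ?f (U ! pc)"
    using nth[of "Suc (2 * pc)"] pc by (simp add: simulate_def)
  have reg: "register (U ! pc) < N" using U(1) pc by simp
  have "step M (Suc (?a + 2 * pc), overlay N R T) = (?f pc', overlay N R' T)" for T
    using step at reg len pc
    by (cases "U ! pc") (auto simp: overlay_def fun_eq_iff split: list.splits if_splits)
  with 1 show ?thesis by (simp add: numeral_2_eq_2 del: step.simps)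
qed

text \<open>\<open>U\<close> must not have halted before step \<open>k\<close>: iterating
  \<open>step U\<close> would then stand still, whereas the simulation has left the fragment and
  stopped counting.\<close>

lemma steps_simulate:
  assumes U: "\<forall>i\<in>set U. register i < N" "N \<le> c"
    and M: "M = P @ simulate U c (length P) @ Q"
    and "\<forall>j<k. \<not> halted U ((step U ^^ j) (0, R))" "(step U ^^ k) (0, R) = (pc', R')"
  shows "(step M ^^ (2 * k)) (length P, overlay N R S) =
    (length P + 2 * min pc' (length U), overlay N R' (S(c := unary k @ S c)))"
  using assms(4,5)
proof (induction k arbitrary: pc' R')
  case 0
  then show ?case by simp
next
  case (Suc k)
  obtain pc1 R1 where k: "(step U ^^ k) (0, R) = (pc1, R1)" by fastforce
  have "\<not> halted U (pc1, R1)" using Suc(2) k by (metis lessI)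
  then have pc: "pc1 < length U" by simp
  have "step U (pc1, R1) = (pc', R')" using Suc(3) k by (simp del: step.simps)
  from step_simulate[OF U pc M this, of "S(c := unary k @ S c)"]
  have "(step M ^^ 2) (length P + 2 * min pc1 (length U), overlay N R1 (S(c := unary k @ S c))) =
    (length P + 2 * min pc' (length U), overlay N R' (S(c := unary (Suc k) @ S c)))"
    using pc by (simp add: min_def)
  moreover have "(step M ^^ (2 * k)) (length P, overlay N R S) =
    (length P + 2 * min pc1 (length U), overlay N R1 (S(c := unary k @ S c)))"
    using Suc(1)[OF _ k] Suc(2) by (simp add: fun_upd_def)
  moreover have "2 * Suc k = 2 + 2 * k" by simp
  ultimately show ?case by (simp only: funpow_add comp_apply)
qed

lemma exec_simulate:
  assumes U: "\<forall>i\<in>set U. register i < N" "N \<le> c" and "outputs_in U p x t"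
  obtains R where "R 0 = x"
    "exec (simulate U c) (overlay N (snd (initial p)) S) (overlay N R (S(c := unary t @ S c)))"
proof -
  obtain pc R where t: "(step U ^^ t) (initial p) = (pc, R)" by fastforce
  have "length U \<le> pc" "R 0 = x" using assms(3) t unfolding outputs_in_def by auto
  have init: "(0, snd (initial p)) = initial p" by (simp add: initial_def)
  have "exec (simulate U c) (overlay N (snd (initial p)) S) (overlay N R (S(c := unary t @ S c)))"
    unfolding exec_def
  proof (intro allI)
    fix P Q :: machine
    let ?M = "P @ simulate U c (length P) @ Q"
    have "(step ?M ^^ (2 * t)) (length P, overlay N (snd (initial p)) S) =
      (length P + 2 * min pc (length U), overlay N R (S(c := unary t @ S c)))"
      by (rule steps_simulate[OF U refl]) (use assms(3) t init in \<open>auto simp: outputs_in_def\<close>)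
    then show "reach ?M (length P, overlay N (snd (initial p)) S)
        (length P + length (simulate U c (length P)), overlay N R (S(c := unary t @ S c)))"
      unfolding reach_def using \<open>length U \<le> pc\<close> by (auto simp: simulate_def min_absorb2)
  qed
  then show ?thesis using that \<open>R 0 = x\<close> by blast
qed

lemma diverges_simulate:
  assumes U: "\<forall>i\<in>set U. register i < N" "N \<le> c" and "\<nexists>x. outputs U p x"
  shows "diverges (simulate U c) (overlay N (snd (initial p)) S)"
  unfolding diverges_def runs_forever_def
proof (intro allI impI notI)
  fix P Q :: machine and d
  let ?M = "P @ simulate U c (length P) @ Q"
  let ?c = "(length P, overlay N (snd (initial p)) S)"
  assume "reach ?M ?c d" and d: "halted ?M d"
  then obtain k where k: "(step ?M ^^ k) ?c = d" unfolding reach_def by blast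
  have init: "(0, snd (initial p)) = initial p" by (simp add: initial_def)
  have nh: "\<not> halted U ((step U ^^ j) (initial p))" for j
    using assms(3) unfolding outputs_iff_reach reach_def by blast
  obtain pc R where pc: "(step U ^^ k) (initial p) = (pc, R)" by fastforce
  \<comment> \<open>A halt after \<open>k\<close> steps persists up to step \<open>2 * k\<close>. By
    then exactly \<open>k\<close> steps of \<open>U\<close> are simulated, and since
    \<open>U\<close> is still running, control is inside the simulating code.\<close>
  have "fst ((step ?M ^^ (2 * k)) ?c) = length P + 2 * min pc (length U)"
    by (subst steps_simulate[OF U refl]) (use nh pc init in auto)
  moreover have "(step ?M ^^ (2 * k)) ?c = d"
    using halted_mono[of ?M k ?c "2 * k"] k d by simp
  moreover have "pc < length U" using nh[of k] pc by simp
  ultimately have "fst d < length ?M" by (simp add: simulate_def)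
  then show False using d by (cases d) simp
qed

section \<open>Three prefix-free machines\<close>

lemma snd_initial: "snd (initial p) = (\<lambda>_. [])(0 := p)"
  by (simp add: initial_def)

text \<open>Registers from \<open>N\<close> on are not used by \<open>U\<close>.\<close>

definition run_logger :: "machine \<Rightarrow> nat \<Rightarrow> frag" where
  "run_logger U N = copy 0 (N + 2) N ;; simulate U (N + 1) ;;
     to_unary 0 (N + 3) (N + 2) ;; to_unary N (N + 4) (N + 2) ;;
     encode_pair (N + 4) (N + 1) (N + 5) (N + 6) ;;
     encode_pair (N + 3) (N + 5) (N + 7) (N + 6) ;;
     from_unary (N + 7) (N + 8) (N + 6) (N + 2) 0"

lemma exec_copy_input:
  assumes "0 < N"
  shows "exec (copy 0 (N + 2) N) (snd (initial p))
    (overlay N (snd (initial p)) ((\<lambda>_. [])(N := p)))"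
  by (rule exec_eq[OF exec_copy])
    (use assms in \<open>auto simp: snd_initial overlay_def fun_eq_iff\<close>)

text \<open>Register \<open>N\<close> saves \<open>p\<close> before \<open>U\<close> consumes it and
  \<open>N + 1\<close> counts steps. \<open>N + 3\<close> and \<open>N + 4\<close> receive the
  numerals of \<open>x\<close> and \<open>p\<close>, \<open>N + 5\<close> and \<open>N + 7\<close>
  the inner and the outer pair; the other registers above \<open>N\<close> are scratch
  space.\<close>

lemma outputs_run_logger:
  assumes U: "\<forall>i\<in>set U. register i < N" and "0 < N" and "outputs_in U p x t"
  shows "outputs (run_logger U N 0) p (triple (x, p, str_of_num t))"
proof -
  obtain R where R: "R 0 = x" "exec (simulate U (N + 1))
      (overlay N (snd (initial p)) ((\<lambda>_. [])(N := p)))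
      (overlay N R ((\<lambda>_. [])(N := p, N + 1 := unary t)))"
    using exec_simulate[OF U _ assms(3), of "N + 1" "(\<lambda>_. [])(N := p)"] by auto
  define R1 where "R1 = overlay N R ((\<lambda>_. [])(N := p, N + 1 := unary t))"
  have R1: "R1 0 = x" "R1 N = p" "R1 (N + 1) = unary t"
    "\<And>r. N + 2 \<le> r \<Longrightarrow> R1 r = []"
    using R(1) assms(2) by (auto simp: R1_def overlay_def)
  define a where "a = prod_encode (num_of_str p, t)"
  define R2 where "R2 = R1(0 := [], N + 3 := unary (num_of_str x))"
  define R3 where "R3 = R2(N := [], N + 4 := unary (num_of_str p))"
  define R4 where "R4 = R3(N + 4 := [], N + 1 := [], N + 5 := unary a)"
  define R5 where "R5 = R4(N + 3 := [], N + 5 := [],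
    N + 7 := unary (prod_encode (num_of_str x, a)))"
  define R6 where "R6 = R5(N + 7 := [], 0 := str_of_num (prod_encode (num_of_str x, a)))"
  have e1: "exec (to_unary 0 (N + 3) (N + 2)) R1 R2"
    by (rule exec_eq[OF exec_to_unary]) (use R1 assms(2) in \<open>auto simp: R2_def\<close>)
  have e2: "exec (to_unary N (N + 4) (N + 2)) R2 R3"
    by (rule exec_eq[OF exec_to_unary]) (use R1 assms(2) in \<open>auto simp: R3_def R2_def\<close>)
  have e3: "exec (encode_pair (N + 4) (N + 1) (N + 5) (N + 6)) R3 R4"
    by (rule exec_eq[OF exec_encode_pair[of _ _ _ _ _ "num_of_str p" t]])
      (use R1 assms(2) in \<open>auto simp: R4_def R3_def R2_def a_def\<close>)
  have e4: "exec (encode_pair (N + 3) (N + 5) (N + 7) (N + 6)) R4 R5"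
    by (rule exec_eq[OF exec_encode_pair[of _ _ _ _ _ "num_of_str x" a]])
      (use R1 assms(2) in \<open>auto simp: R5_def R4_def R3_def R2_def\<close>)
  have e5: "exec (from_unary (N + 7) (N + 8) (N + 6) (N + 2) 0) R5 R6"
    by (rule exec_eq[OF exec_from_unary])
      (use R1 assms(2) in \<open>auto simp: R6_def R5_def R4_def R3_def R2_def\<close>)
  have "exec (run_logger U N) (snd (initial p)) R6"
    unfolding run_logger_def
    by (rule exec_seq[OF exec_copy_input[OF assms(2)] exec_seq[OF R(2)[folded R1_def]
          exec_seq[OF e1 exec_seq[OF e2 exec_seq[OF e3 exec_seq[OF e4 e5]]]]]])
  from exec_outputs[OF this] show ?thesis
    by (simp add: R6_def a_def)
qed

text \<open>Copying the input always terminates, and the simulation that follows diverges wherever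
  \<open>U\<close> does. This inclusion of domains is what yields prefix-freeness.\<close>

lemma run_logger_domain:
  assumes U: "\<forall>i\<in>set U. register i < N" and "0 < N" and "outputs (run_logger U N 0) p y"
  shows "\<exists>x. outputs U p x"
proof (rule ccontr)
  assume "\<nexists>x. outputs U p x"
  then have "diverges (run_logger U N) (snd (initial p))"
    unfolding run_logger_def
    by (intro diverges_seq2[OF exec_copy_input[OF assms(2)]] diverges_seq1 diverges_simulate[OF U])
      simp_all
  then show False using diverges_outputs assms(3) by blast
qed

text \<open>From a program of \<open>y\<close> it computes the first \<open>i\<close> bits of
  \<open>y\<close>, where \<open>i\<close> is the left component of the pair coded by the length of
  \<open>y\<close>. For y = A|m and m the number of <n,p,t>, this \<open>i\<close> is
  \<open>n\<close>.\<close>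

definition initial_segment :: "machine \<Rightarrow> nat \<Rightarrow> frag" where
  "initial_segment U N = simulate U N ;; copy 0 (N + 1) (N + 2) ;;
     decode_pair (N + 2) (N + 3) (N + 4) ;; truncate 0 (N + 3) (N + 1)"

lemma overlay_initial:
  assumes "0 < N"
  shows "snd (initial p) = overlay N (snd (initial p)) (\<lambda>_. [])"
  using assms by (auto simp: snd_initial overlay_def fun_eq_iff)

lemma outputs_initial_segment:
  assumes U: "\<forall>i\<in>set U. register i < N" and "0 < N" and "outputs U p y"
  shows "outputs (initial_segment U N 0) p (take (fst (prod_decode (length y))) y)"
proof -
  obtain t where "outputs_in U p y t" using assms(3) unfolding outputs_def by blast
  then obtain R where R: "R 0 = y" "exec (simulate U N)
      (snd (initial p)) (overlay N R ((\<lambda>_. [])(N := unary t)))"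
    using exec_simulate[OF U _, of N p y t "\<lambda>_. []"] overlay_initial[OF assms(2), of p] by auto
  obtain i j where ij: "prod_decode (length y) = (i, j)" by fastforce
  define R1 where "R1 = overlay N R ((\<lambda>_. [])(N := unary t))"
  have R1: "R1 0 = y" "\<And>r. N + 1 \<le> r \<Longrightarrow> R1 r = []"
    using R(1) assms(2) by (auto simp: R1_def overlay_def)
  define R2 where "R2 = R1(N + 2 := y)"
  define R3 where "R3 = R2(N + 2 := [], N + 3 := unary i, N + 4 := unary j)"
  define R4 where "R4 = R3(N + 3 := [], 0 := take i y)"
  \<comment> \<open>\<open>decode_pair\<close> depends only on the length of its input register, so
    a copy of \<open>y\<close> serves as the numeral of its own length.\<close>
  have e1: "exec (copy 0 (N + 1) (N + 2)) R1 R2"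
    by (rule exec_eq[OF exec_copy]) (use R1 assms(2) in \<open>auto simp: R2_def\<close>)
  have e2: "exec (decode_pair (N + 2) (N + 3) (N + 4)) R2 R3"
    by (rule exec_eq[OF exec_decode_pair[of _ _ _ _ i j]])
      (use R1 assms(2) ij in \<open>auto simp: R3_def R2_def\<close>)
  have e3: "exec (truncate 0 (N + 3) (N + 1)) R3 R4"
    by (rule exec_eq[OF exec_truncate])
      (use R1 assms(2) in \<open>auto simp: R4_def R3_def R2_def\<close>)
  have "exec (initial_segment U N) (snd (initial p)) R4"
    unfolding initial_segment_def
    by (rule exec_seq[OF R(2)[folded R1_def] exec_seq[OF e1 exec_seq[OF e2 e3]]])
  from exec_outputs[OF this] show ?thesis by (simp add: R4_def ij)
qed

lemma initial_segment_domain: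
  assumes U: "\<forall>i\<in>set U. register i < N" and "0 < N" and "outputs (initial_segment U N 0) p y"
  shows "\<exists>x. outputs U p x"
proof (rule ccontr)
  assume "\<nexists>x. outputs U p x"
  then have "diverges (initial_segment U N) (snd (initial p))"
    unfolding initial_segment_def
    by (subst overlay_initial[OF assms(2)])
      (intro diverges_seq1 diverges_simulate[OF U]; simp)
  then show False using diverges_outputs assms(3) by blast
qed

section \<open>A self-delimiting code and its decoder\<close>

fun delimit :: "str \<Rightarrow> str" where
  "delimit [] = [False]"
| "delimit (b # x) = True # b # delimit x"

text \<open>\<open>True\<close> announces a further bit and \<open>False\<close> ends the word. The
  length exceeds the default value of \<open>g_S\<close> at the encoded string by just 1.\<close>

lemma length_delimit: "length (delimit x) = 2 * length x + 1"
  by (induction x) auto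

lemma delimit_append_inject: "delimit x @ w = delimit y @ w' \<longleftrightarrow> x = y \<and> w = w'"
  by (induction x arbitrary: y; case_tac y) auto

text \<open>Register 2 is the flag for another round and register 1 collects the decoded bits in
  reverse. Input that breaks off inside a code word leads into \<open>hang\<close>.\<close>

definition read_delimited :: frag where
  "read_delimited = loop 2 (\<lambda>_. cases 0
     (\<lambda>b. if b then cases 0 (\<lambda>b. push 1 b ;; push 2 True) hang else skip) hang)"

lemma exec_read_delimited:
  "R 0 = delimit x @ w \<Longrightarrow> R 2 = [True] \<Longrightarrow>
    exec read_delimited R (R(0 := w, 1 := rev x @ R 1, 2 := []))"
proof (induction x arbitrary: R)
  case Nil
  let ?R = "R(0 := w, 2 := [])"
  have "exec (cases 0 (\<lambda>b. if b then cases 0 (\<lambda>b. push 1 b ;; push 2 True) hang else skip) hang)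
      (R(2 := [])) ?R"
    by (rule exec_cases_Cons[of _ _ False w], use Nil in simp)
      (use exec_skip in \<open>simp add: fun_upd_twist\<close>)
  moreover have "exec read_delimited ?R ?R"
    unfolding read_delimited_def by (rule exec_loop_Nil) simp
  ultimately have "exec read_delimited R ?R"
    using Nil(2) unfolding read_delimited_def by (intro exec_loop_Cons[of R 2 True "[]"]) auto
  then show ?case by (rule exec_eq) auto
next
  case (Cons b x)
  let ?R = "R(0 := delimit x @ w, 1 := b # R 1)"
  let ?R' = "R(2 := [], 0 := b # delimit x @ w)"
  have "exec (push 1 b ;; push 2 True) (?R'(0 := delimit x @ w)) ?R"
    by (rule exec_eq[OF exec_seq[OF exec_push exec_push]]) (use Cons in \<open>auto simp: fun_eq_iff\<close>)
  then have "exec (cases 0 (\<lambda>b. push 1 b ;; push 2 True) hang) ?R' ?R"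
    by (intro exec_cases_Cons[of _ _ b "delimit x @ w"]) auto
  then have "exec (cases 0 (\<lambda>b. if b then cases 0 (\<lambda>b. push 1 b ;; push 2 True) hang else skip) hang)
      (R(2 := [])) ?R"
    by (intro exec_cases_Cons[of _ _ True "b # delimit x @ w"]) (use Cons in auto)
  moreover have "exec read_delimited ?R (?R(0 := w, 1 := rev x @ ?R 1, 2 := []))"
    by (rule Cons(1)) (use Cons(3) in auto)
  ultimately have "exec read_delimited R (?R(0 := w, 1 := rev x @ ?R 1, 2 := []))"
    using Cons(3) unfolding read_delimited_def by (intro exec_loop_Cons[of R 2 True "[]"]) auto
  then show ?case by (rule exec_eq) auto
qed

text \<open>Each completed round removes two bits, and the rest still has no code word as a prefix.
  Hence the input finally runs out where an announcing bit or an announced bit is expected.\<close>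

lemma diverges_read_delimited:
  "\<nexists>x w. R 0 = delimit x @ w \<Longrightarrow> R 2 = [True] \<Longrightarrow> diverges read_delimited R"
proof (induction "length (R 0)" arbitrary: R rule: less_induct)
  case less
  let ?B = "\<lambda>b. if b then cases 0 (\<lambda>b. push 1 b ;; push 2 True) hang else skip"
  show ?case
  proof (cases "\<exists>b w. R 0 = True # b # w")
    case True
    then obtain b w where w: "R 0 = True # b # w" by blast
    let ?R = "R(0 := w, 1 := b # R 1)"
    let ?R' = "R(2 := [], 0 := b # w)"
    have "exec (push 1 b ;; push 2 True) (?R'(0 := w)) ?R"
      by (rule exec_eq[OF exec_seq[OF exec_push exec_push]]) (use less in \<open>auto simp: fun_eq_iff\<close>)
    then have "exec (cases 0 (\<lambda>b. push 1 b ;; push 2 True) hang) ?R' ?R"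
      by (intro exec_cases_Cons[of _ _ b w]) auto
    then have "exec (cases 0 ?B hang) (R(2 := [])) ?R"
      by (intro exec_cases_Cons[of _ _ True "b # w"]) (use w in auto)
    moreover have "diverges read_delimited ?R"
    proof (rule less(1))
      show "\<nexists>x v. ?R 0 = delimit x @ v"
      proof
        assume "\<exists>x v. ?R 0 = delimit x @ v"
        then obtain x v where "w = delimit x @ v" by auto
        then have "R 0 = delimit (b # x) @ v" using w by simp
        then show False using less(2) by blast
      qed
    qed (use less w in auto)
    ultimately show ?thesis
      using less(3) unfolding read_delimited_def by (intro diverges_loop_Cons[of R 2 True "[]"]) auto
  next
    case False
    moreover have "R 0 \<noteq> False # w" for w
      using less(2) by (metis append_Cons append_Nil delimit.simps(1))
    ultimately consider "R 0 = []" | "R 0 = [True]"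
      by (metis (full_types) neq_Nil_conv)
    then have "diverges (cases 0 ?B hang) (R(2 := []))"
    proof cases
      case 1
      then show ?thesis by (intro diverges_branch_Nil diverges_hang) auto
    next
      case 2
      have "diverges (cases 0 (\<lambda>b. push 1 b ;; push 2 True) hang) (R(2 := [], 0 := []))"
        by (intro diverges_branch_Nil diverges_hang) auto
      then show ?thesis by (intro diverges_branch_Cons[of _ _ True "[]"]) (use 2 in auto)
    qed
    then show ?thesis
      using less(3) unfolding read_delimited_def
      by (intro diverges_branch_Cons[of R 2 True "[]"]) auto
  qed
qed

text \<open>Input left over behind the code word causes divergence. The domain is thus exactly the
  set of code words, which is prefix-free.\<close>

definition undelimit :: frag where
  "undelimit = push 2 True ;; read_delimited ;; cases 0 (\<lambda>_. hang) skip ;; pour 1 0"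

lemma outputs_undelimit_iff: "outputs (undelimit 0) p x \<longleftrightarrow> p = delimit x"
proof (cases "\<exists>x w. p = delimit x @ w")
  case True
  then obtain y w where p: "p = delimit y @ w" by blast
  let ?R = "(\<lambda>_. [])(0 := w, 1 := rev y)"
  have init: "exec (push 2 True) (snd (initial p)) ((\<lambda>_. [])(0 := p, 2 := [True]))"
    by (rule exec_eq[OF exec_push]) (auto simp: snd_initial)
  have read: "exec read_delimited ((\<lambda>_. [])(0 := p, 2 := [True])) ?R"
    by (rule exec_eq[OF exec_read_delimited[of _ y w]]) (auto simp: p fun_eq_iff)
  show ?thesis
  proof (cases w)
    case Nil
    have "exec undelimit (snd (initial p)) (?R(1 := [], 0 := y))"
      unfolding undelimit_def
      by (rule exec_eq[OF exec_seq[OF init exec_seq[OF read exec_seq[OF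
              exec_branch_Nil[OF _ exec_skip] exec_pour]]]]) (use Nil in auto)
    from exec_outputs[OF this] show ?thesis
      using p Nil delimit_append_inject[of y "[]" x "[]"] by auto
  next
    case (Cons b v)
    have "diverges undelimit (snd (initial p))"
      unfolding undelimit_def
      by (intro diverges_seq2[OF init] diverges_seq2[OF read] diverges_seq1
          diverges_branch_Cons[of _ _ b v] diverges_hang) (use Cons in auto)
    then show ?thesis
      using diverges_outputs p Cons delimit_append_inject[of y w x "[]"] by auto
  qed
next
  case False
  have init: "exec (push 2 True) (snd (initial p)) ((\<lambda>_. [])(0 := p, 2 := [True]))"
    by (rule exec_eq[OF exec_push]) (auto simp: snd_initial)
  have "diverges undelimit (snd (initial p))"
    unfolding undelimit_def
    by (intro diverges_seq2[OF init] diverges_seq1 diverges_read_delimited) (use False in auto)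
  then show ?thesis using diverges_outputs False by (metis append_Nil2)
qed

section \<open>Complexity bounds\<close>

lemma prefix_free_machine_domain:
  assumes "prefix_free_machine U" "\<And>p y. outputs M p y \<Longrightarrow> \<exists>x. outputs U p x"
  shows "prefix_free_machine M"
  using assms unfolding prefix_free_machine_def by meson

lemma prefix_free_undelimit: "prefix_free_machine (undelimit 0)"
  unfolding prefix_free_machine_def outputs_undelimit_iff
  using delimit_append_inject[of _ "[]"] by (auto simp: prefix_def)

lemma K_le_length: "outputs U p x \<Longrightarrow> K U x \<le> enat (length p)"
  unfolding K_def by (rule INF_lower) simp

text \<open>The infimum of a nonempty set of extended naturals is a member of it; the program
  \<open>q\<close> supplies nonemptiness, without which \<open>K\<close> would be infinite.\<close>

lemma K_attained:
  assumes "outputs U q x"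
  obtains p where "outputs U p x" "K U x = enat (length p)"
proof -
  let ?A = "(\<lambda>p. enat (length p)) ` {p. outputs U p x}"
  have "K U x = (LEAST k. k \<in> ?A)"
    using assms by (auto simp: K_def Inf_enat_def)
  moreover have "(LEAST k. k \<in> ?A) \<in> ?A"
    by (rule LeastI[of _ "enat (length q)"]) (use assms in auto)
  ultimately show ?thesis using that by auto
qed

text \<open>The constant is the length of the prefix by which \<open>U\<close> simulates
  \<open>M\<close>.\<close>

lemma K_universal:
  assumes "universal_prefix_free U" "prefix_free_machine M"
  obtains d where "\<And>p x. outputs M p x \<Longrightarrow> K U x \<le> enat (length p + d)"
proof -
  obtain \<rho> where "\<forall>p x. outputs U (\<rho> @ p) x \<longleftrightarrow> outputs M p x"
    using assms unfolding universal_prefix_free_def by blast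
  then have "K U x \<le> enat (length p + length \<rho>)" if "outputs M p x" for p x
    using K_le_length[of U "\<rho> @ p" x] that by (simp add: add.commute)
  then show ?thesis using that by blast
qed

lemma registers_bounded:
  obtains N where "\<forall>i\<in>set U. register i < N" "0 < N"
proof
  \<comment> \<open>Inserting 0 keeps the argument of \<open>Max\<close> nonempty even for the empty
    program.\<close>
  show "\<forall>i\<in>set U. register i < Suc (Max (insert 0 (register ` set U)))"
    by (auto simp: less_Suc_eq_le intro!: Max_ge)
qed simp

lemma K_le_g_S:
  assumes "universal_prefix_free U"
  obtains d where "\<And>n. K U (str_of_num n) \<le> enat (g_S U n + d)"
proof -
  obtain N where N: "\<forall>i\<in>set U. register i < N" "0 < N" by (rule registers_bounded)
  have "prefix_free_machine (run_logger U N 0)"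
    using assms prefix_free_machine_domain run_logger_domain[OF N]
    unfolding universal_prefix_free_def by blast
  then obtain d1 where d1: "\<And>p x. outputs (run_logger U N 0) p x \<Longrightarrow> K U x \<le> enat (length p + d1)"
    using K_universal[OF assms] by blast
  obtain d2 where d2: "\<And>p x. outputs (undelimit 0) p x \<Longrightarrow> K U x \<le> enat (length p + d2)"
    using K_universal[OF assms prefix_free_undelimit] by blast
  \<comment> \<open>One constant for both cases: \<open>d1\<close> is the cost of
    \<open>run_logger\<close>, and \<open>d2 + 1\<close> that of \<open>undelimit\<close> together
    with the last bit of the code word.\<close>
  have "K U (str_of_num n) \<le> enat (g_S U n + (d1 + d2 + 1))" for n
  proof -
    obtain x p t where w: "str_of_num n = triple (x, p, t)"
      using bij_is_surj[OF bij_triple] by (metis prod_cases3 surjD)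
    then have n: "n = num_of_str (triple (x, p, t))" by (metis num_of_str_of_num)
    show ?thesis
    proof (cases "outputs_in U p x (num_of_str t)")
      case True
      then have "K U (str_of_num n) \<le> enat (length p + d1)"
        using d1 outputs_run_logger[OF N True] w by (simp del: triple.simps)
      also have "\<dots> \<le> enat (g_S U n + (d1 + d2 + 1))"
        using g_S_triple[of U x p t] True unfolding n by (simp del: triple.simps)
      finally show ?thesis .
    next
      case False
      have "K U (str_of_num n) \<le> enat (length (delimit (str_of_num n)) + d2)"
        by (rule d2) (simp add: outputs_undelimit_iff)
      also have "\<dots> \<le> enat (g_S U n + (d1 + d2 + 1))"
        using g_S_triple[of U x p t] False w unfolding n
        by (simp add: length_delimit del: triple.simps)
      finally show ?thesis .
    qed
  qed
  then show ?thesis using that by blast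
qed

lemma take_restrict_seq: "n \<le> m \<Longrightarrow> take n (restrict_seq A m) = restrict_seq A n"
  by (simp add: restrict_seq_def take_map)

lemma g_trivial_imp_K_trivial:
  assumes U: "universal_prefix_free U" and "g_trivial U (g_S U) A"
  shows "K_trivial U A"
proof -
  obtain N where N: "\<forall>i\<in>set U. register i < N" "0 < N" by (rule registers_bounded)
  have "prefix_free_machine (initial_segment U N 0)"
    using U prefix_free_machine_domain initial_segment_domain[OF N]
    unfolding universal_prefix_free_def by blast
  then obtain d where d:
      "\<And>p x. outputs (initial_segment U N 0) p x \<Longrightarrow> K U x \<le> enat (length p + d)"
    using K_universal[OF U] by blast
  \<comment> \<open>Every string has a program by way of its code word, so the shortest programs
    chosen below exist.\<close>
  obtain \<rho> where \<rho>: "\<And>x. outputs U (\<rho> @ delimit x) x"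
    using U prefix_free_undelimit outputs_undelimit_iff
    unfolding universal_prefix_free_def by metis
  obtain c where c: "\<And>n. K U (restrict_seq A n) \<le> enat (g_S U n + c)"
    using assms(2) unfolding g_trivial_def by blast
  \<comment> \<open>\<open>c\<close> is paid for the triviality bound at the number \<open>m\<close>
    of the triple, \<open>d\<close> for passing through \<open>initial_segment\<close>.\<close>
  have "K U (restrict_seq A n) \<le> K U (str_of_num n) + enat (c + d)" for n
  proof -
    obtain p where p: "outputs U p (str_of_num n)" "K U (str_of_num n) = enat (length p)"
      using K_attained[OF \<rho>] by blast
    obtain t where t: "outputs_in U p (str_of_num n) t" using p(1) unfolding outputs_def by blast
    define m where "m = prod_encode (n, prod_encode (num_of_str p, t))"
    have m: "m = num_of_str (triple (str_of_num n, p, str_of_num t))" by (simp add: m_def)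
    have "g_S U m = length p" unfolding m g_S_triple using t by simp
    obtain q where q: "outputs U q (restrict_seq A m)" "K U (restrict_seq A m) = enat (length q)"
      using K_attained[OF \<rho>] by blast
    have "n \<le> m" unfolding m_def by (rule le_prod_encode_1)
    moreover have "length (restrict_seq A m) = m" by (simp add: restrict_seq_def)
    ultimately have "outputs (initial_segment U N 0) q (restrict_seq A n)"
      using outputs_initial_segment[OF N q(1)] by (simp add: take_restrict_seq m_def)
    then have "K U (restrict_seq A n) \<le> enat (length q + d)" by (rule d)
    moreover have "length q \<le> length p + c"
      using c[of m] q(2) \<open>g_S U m = length p\<close> by simp
    ultimately show ?thesis using p(2) by (simp add: order_trans)
  qed
  then show ?thesis unfolding K_trivial_def by blast
qed

theorem mainTheorem8:
  fixes U :: machine and A :: "nat \<Rightarrow> bool"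
  assumes "universal_prefix_free U"
  shows "K_trivial U A \<longleftrightarrow> g_trivial U (g_S U) A"
proof
  assume "K_trivial U A"
  then obtain c where c: "\<And>n. K U (restrict_seq A n) \<le> K U (str_of_num n) + enat c"
    unfolding K_trivial_def by blast
  obtain d where d: "\<And>n. K U (str_of_num n) \<le> enat (g_S U n + d)"
    using K_le_g_S[OF assms] by blast
  have "K U (restrict_seq A n) \<le> enat (g_S U n + (d + c))" for n
    using order_trans[OF c add_right_mono[OF d, where c = "enat c"]] by (simp add: add.assoc)
  then show "g_trivial U (g_S U) A" unfolding g_trivial_def by blast
next
  assume "g_trivial U (g_S U) A"
  with assms show "K_trivial U A" by (rule g_trivial_imp_K_trivial)
qed

end
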